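(* Let $(G,\tau)$ be a countably infinite precompact metrizable abelian group. Then there exists a Hausdorff group topology $\eta$ on $G$ which is strictly finer than $\tau$ and strongly compatible with $\tau$. In particular, $(G,\tau)$ is not a $MAP$-Mackey group.
   Context: All topological groups are Hausdorff and abelian. $\mathbb{T}=\mathbb{R}/\mathbb{Z}$. A group topology on $G$ is precompact if for every neighborhood $U$ of $0$ there is a finite $F\subseteq G$ with $F+U=G$. For a topological abelian group $(G,\tau)$, $(G,\tau)^\ast$ denotes the group of all continuous characters $G\to\mathbb{T}$, and $(G,\tau)^\wedge$ denotes $(G,\tau)^\ast$ endowed with the compact-open topology. If $\tau,\eta$ are group topologies on $G$, then $\eta$ is compatible with $\tau$ if $(G,\eta)^\ast=(G,\tau)^\ast$, and strongly compatible with $\tau$ if $(G,\eta)^\wedge=(G,\tau)^\wedge$ as topological groups. A topological abelian group $G$ is maximally almost periodic (a $MAP$-group) if $G^\ast$ separates the points of $G$. A topological group $(G,\mu)$ is a $MAP$-Mackey group if $(G,\mu)$ is a $MAP$-group and, for every group topology $\nu$ on $G$ that is compatible with $\mu$ and such that $(G,\nu)$ is a $MAP$-group, one has $\nu\le\mu$. *)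

theory Defs
  imports "HOL-Analysis.Analysis" "HOL-Library.Set_Algebras"
begin

text \<open>The circle group $\mathbb{R}/\mathbb{Z}$, written additively, with the quotient topology.\<close>

quotient_type circle = real / "\<lambda>x y. x - y \<in> \<int>"
  morphisms rep_circle to_circle
proof (rule equivpI)
  show "reflp (\<lambda>x y::real. x - y \<in> \<int>)"
    by (simp add: reflp_def)
  show "symp (\<lambda>x y::real. x - y \<in> \<int>)"
    by (metis (lifting) Ints_minus minus_diff_eq sympI)
  show "transp (\<lambda>x y::real. x - y \<in> \<int>)"
  proof (rule transpI)
    fix x y z :: real
    assume "x - y \<in> \<int>" "y - z \<in> \<int>"
    then have "(x - y) + (y - z) \<in> \<int>" by (rule Ints_add)
    then show "x - z \<in> \<int>" by simp
  qed
qed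

instantiation circle :: ab_group_add
begin

lift_definition zero_circle :: circle is 0 .

lift_definition plus_circle :: "circle \<Rightarrow> circle \<Rightarrow> circle" is "(+)"
  by (metis (no_types, lifting) Ints_add add_diff_add)

lift_definition uminus_circle :: "circle \<Rightarrow> circle" is uminus
  by (metis Ints_minus minus_diff_minus)

lift_definition minus_circle :: "circle \<Rightarrow> circle \<Rightarrow> circle" is "(-)"
proof -
  fix a b c d :: real
  assume "a - b \<in> \<int>" "c - d \<in> \<int>"
  then have "(a - b) - (c - d) \<in> \<int>" by (rule Ints_diff)
  then show "(a - c) - (b - d) \<in> \<int>" by (simp add: algebra_simps)
qed

instance
  by standard (transfer; simp add: algebra_simps)+

end

instantiation circle :: topological_space
begin

definition open_circle :: "circle set \<Rightarrow> bool" where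
  "open_circle U \<longleftrightarrow> open (to_circle -` U)"

instance
  by standard (auto simp: open_circle_def vimage_Union)

end

text \<open>
  The group is the whole type, so that several topologies on the same group can be compared;
  all group topologies are Hausdorff.
\<close>

definition group_topology :: "'a::ab_group_add topology \<Rightarrow> bool" where
  "group_topology T \<longleftrightarrow>
     topspace T = UNIV \<and>
     continuous_map (prod_topology T T) T (\<lambda>(x, y). x + y) \<and>
     continuous_map T T uminus \<and>
     Hausdorff_space T"

definition precompact_topology :: "'a::ab_group_add topology \<Rightarrow> bool" where
  "precompact_topology T \<longleftrightarrow>
     (\<forall>U. (\<exists>V. openin T V \<and> 0 \<in> V \<and> V \<subseteq> U) \<longrightarrow> (\<exists>F. finite F \<and> F + U = UNIV))"

definition finer_topology :: "'a topology \<Rightarrow> 'a topology \<Rightarrow> bool" where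
  "finer_topology S T \<longleftrightarrow> (\<forall>U. openin T U \<longrightarrow> openin S U)"

definition strictly_finer_topology :: "'a topology \<Rightarrow> 'a topology \<Rightarrow> bool" where
  "strictly_finer_topology S T \<longleftrightarrow> finer_topology S T \<and> S \<noteq> T"

definition characters :: "'a::ab_group_add topology \<Rightarrow> ('a \<Rightarrow> circle) set" where
  "characters T = {f. Modules.additive f \<and> continuous_map T euclidean f}"

text \<open>The compact-open topology on the group of continuous characters; this group is its
  \<^const>\<open>topspace\<close>, with pointwise addition.\<close>

definition dual_topology :: "'a::ab_group_add topology \<Rightarrow> ('a \<Rightarrow> circle) topology" where
  "dual_topology T =
     topology_generated_by
       {{f \<in> characters T. f ` K \<subseteq> U} | K U. compactin T K \<and> open U}"

lemma topspace_dual_topology: "topspace (dual_topology T) = characters T"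
proof -
  have "characters T \<in> {{f \<in> characters T. f ` K \<subseteq> U} | K U. compactin T K \<and> open U}"
    by (rule CollectI, rule exI[of _ "{}"], rule exI[of _ UNIV]) auto
  then show ?thesis
    unfolding dual_topology_def topology_generated_by_topspace by auto
qed

definition compatible :: "'a::ab_group_add topology \<Rightarrow> 'a topology \<Rightarrow> bool" where
  "compatible S T \<longleftrightarrow> characters S = characters T"

text \<open>Equality of the two dual topologies includes equality of the underlying sets; the group
  operation is pointwise addition on both sides, so this is equality as topological groups.\<close>

definition strongly_compatible :: "'a::ab_group_add topology \<Rightarrow> 'a topology \<Rightarrow> bool" where
  "strongly_compatible S T \<longleftrightarrow> dual_topology S = dual_topology T"

lemma strongly_compatible_imp_compatible: "strongly_compatible S T \<Longrightarrow> compatible S T"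
  unfolding strongly_compatible_def compatible_def by (metis topspace_dual_topology)

definition MAP_group :: "'a::ab_group_add topology \<Rightarrow> bool" where
  "MAP_group T \<longleftrightarrow>
     group_topology T \<and> (\<forall>x y. x \<noteq> y \<longrightarrow> (\<exists>f \<in> characters T. f x \<noteq> f y))"

definition MAP_Mackey_group :: "'a::ab_group_add topology \<Rightarrow> bool" where
  "MAP_Mackey_group T \<longleftrightarrow>
     MAP_group T \<and>
     (\<forall>S. group_topology S \<and> compatible S T \<and> MAP_group S \<longrightarrow> finer_topology T S)"

end

theory Submission
  imports Defs
begin

text \<open>
  Write \<open>\<tau>\<close> through a decreasing sequence of symmetric neighbourhoods \<open>V n\<close> of zero with
  \<open>V (n + 1) + V (n + 1) \<subseteq> V n\<close> and \<open>V 0 = UNIV\<close>. The topology \<open>\<eta>\<close> is built around one null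
  sequence of \<open>\<tau>\<close>, enumerated as a union of finite sets \<open>E j \<subseteq> V j\<close>, which serves three purposes.

  \<^item> It decides continuity of characters: an additive \<open>f\<close> into the circle that is small on all
    \<open>E j\<close> with \<open>j \<ge> N\<close> is \<open>\<tau>\<close>-continuous (\<open>detecting_sets\<close>). Precompactness gives finite sets of
    digits such that every element of \<open>V (2 N)\<close> is a digit plus an element of \<open>V (2 N + 2)\<close>;
    since the group is countable, the remainders of this greedy expansion can be added to the finite
    sets so that each expansion stops. The sets \<open>E j\<close> also contain the first \<open>j\<close> iterated doubles
    of the digits, which makes the value of \<open>f\<close> on a \<open>j\<close>-th digit at most of order \<open>2\<^sup>-\<^sup>j\<close>,
    and the expansion bounds \<open>f\<close> by a geometric series. Hence every group topology
    finer than \<open>\<tau>\<close> in which the sequence still tends to zero has the same characters as \<open>\<tau>\<close>.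
  \<^item> It makes the dual discrete (\<open>dual_topology_discrete\<close>): the case \<open>N = 0\<close> says that only the
    trivial character is small on the whole sequence, and the sequence together with zero is compact
    in any topology in which it tends to zero. So all the topologies just mentioned are strongly
    compatible with \<open>\<tau>\<close>.
  \<^item> It still converges in a strictly finer group topology (\<open>strictly_finer_with_null_sets\<close>). Sums of
    a bounded number of its terms are nowhere dense, so there are \<open>h q \<in> V q\<close> away from all sums of
    \<open>q\<close> terms. Sums of arbitrary length in which the later terms are required to lie very
    far out in the sequence still avoid all \<open>h q\<close>, and such sums form neighbourhoods of zero of a group
    topology.

  The failure of the Mackey property follows, because \<open>\<eta>\<close> and \<open>\<tau>\<close> have the same characters.
\<close>

section \<open>A norm on the circle\<close>

lift_definition cnorm :: "circle \<Rightarrow> real" is "\<lambda>x. \<bar>x - of_int (round x)\<bar>"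
proof -
  fix x y :: real assume "x - y \<in> \<int>"
  then obtain k where k: "x = y + of_int k" by (metis Ints_cases add.commute diff_add_cancel)
  have "round x = round y + k"
    unfolding k round_def by (metis (no_types, lifting) add.assoc add.commute floor_add_int)
  then show "\<bar>x - of_int (round x)\<bar> = \<bar>y - of_int (round y)\<bar>" using k by simp
qed

lemma cnorm_nonneg [simp]: "0 \<le> cnorm c"
  by transfer simp

lemma cnorm_to_circle_le: "cnorm (to_circle x) \<le> \<bar>x\<bar>"
  by transfer (metis diff_zero of_int_0 round_diff_minimal)

lemma cnorm_to_circle_eq:
  assumes "\<bar>x\<bar> \<le> 1 / 2"
  shows "cnorm (to_circle x) = \<bar>x\<bar>"
proof -
  have "\<bar>x\<bar> \<le> \<bar>x - of_int k\<bar>" for k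
  proof (cases "k = 0")
    case False
    then have "1 \<le> \<bar>of_int k :: real\<bar>" by linarith
    then show ?thesis using assms by linarith
  qed simp
  then have "\<bar>x\<bar> \<le> cnorm (to_circle x)" by transfer
  then show ?thesis using cnorm_to_circle_le[of x] by simp
qed

lemma to_circle_add: "to_circle (x + y) = to_circle x + to_circle y"
  by (simp add: plus_circle.abs_eq)

lemma to_circle_diff: "to_circle (x - y) = to_circle x - to_circle y"
  by (simp add: minus_circle.abs_eq)

lemma to_circle_surj: obtains x where "to_circle x = c"
  by (metis Quotient3_abs_rep Quotient3_circle)

lemma cnorm_representative:
  obtains x where "to_circle x = c" "\<bar>x\<bar> = cnorm c"
proof -
  obtain r where r: "to_circle r = c" by (rule to_circle_surj)
  have "to_circle (r - of_int (round r)) = to_circle r"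
    unfolding circle.abs_eq_iff by simp
  moreover have "\<bar>r - of_int (round r)\<bar> = cnorm c"
    unfolding r[symmetric] by transfer simp
  ultimately show ?thesis using r that by metis
qed

lemma cnorm_zero [simp]: "cnorm 0 = 0"
  by transfer simp

lemma cnorm_eq_0D: "cnorm c = 0 \<Longrightarrow> c = 0"
  by (rule cnorm_representative[of c]) (auto simp: zero_circle_def)

lemma cnorm_minus [simp]: "cnorm (- c) = cnorm c"
proof -
  have le: "cnorm (- d) \<le> cnorm d" for d
    by (rule cnorm_representative[of d])
      (metis abs_minus_cancel cnorm_to_circle_le uminus_circle.abs_eq)
  show ?thesis using le[of c] le[of "- c"] by simp
qed

lemma cnorm_triangle: "cnorm (a + b) \<le> cnorm a + cnorm b"
proof -
  obtain x y where "to_circle x = a" "\<bar>x\<bar> = cnorm a" "to_circle y = b" "\<bar>y\<bar> = cnorm b"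
    by (metis cnorm_representative)
  then show ?thesis using cnorm_to_circle_le[of "x + y"] by (auto simp: to_circle_add)
qed

lemma cnorm_triangle_diff: "cnorm (a - b) \<le> cnorm a + cnorm b"
  using cnorm_triangle[of a "- b"] by simp

lemma cnorm_double:
  assumes "cnorm c \<le> 1 / 4"
  shows "cnorm (c + c) = 2 * cnorm c"
proof -
  obtain x where x: "to_circle x = c" "\<bar>x\<bar> = cnorm c" by (rule cnorm_representative)
  have "cnorm (to_circle (x + x)) = \<bar>x + x\<bar>"
    using x assms by (intro cnorm_to_circle_eq) auto
  moreover have "\<bar>x + x\<bar> = 2 * \<bar>x\<bar>" by simp
  ultimately show ?thesis unfolding to_circle_add x by simp
qed

lemma open_cnorm_ball: "open {d. cnorm (d - c) < e}"
proof -
  obtain y where y: "to_circle y = c" by (rule to_circle_surj)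
  have "open {x. cnorm (to_circle (x - y)) < e}"
    unfolding open_dist mem_Collect_eq Ball_Collect subset_iff
  proof (intro allI impI)
    fix x assume x: "cnorm (to_circle (x - y)) < e"
    have "cnorm (to_circle (z - y)) < e" if "dist z x < e - cnorm (to_circle (x - y))" for z
    proof -
      have "cnorm (to_circle (z - y)) \<le> cnorm (to_circle (x - y)) + cnorm (to_circle (z - x))"
        using cnorm_triangle[of "to_circle (x - y)" "to_circle (z - x)"]
        by (simp flip: to_circle_add)
      also have "\<dots> \<le> cnorm (to_circle (x - y)) + \<bar>z - x\<bar>"
        using cnorm_to_circle_le by simp
      finally show ?thesis using that by (simp add: dist_real_def)
    qed
    then show "\<exists>r>0. \<forall>z. dist z x < r \<longrightarrow> cnorm (to_circle (z - y)) < e"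
      using x by (intro exI[of _ "e - cnorm (to_circle (x - y))"]) auto
  qed
  then show ?thesis by (simp add: open_circle_def vimage_def to_circle_diff y)
qed

lemma open_circle_contains_ball:
  assumes "open U" "c \<in> U"
  obtains e where "e > 0" "\<And>d. cnorm d < e \<Longrightarrow> c + d \<in> U"
proof -
  obtain x where x: "to_circle x = c" by (rule to_circle_surj)
  have "open (to_circle -` U)" "x \<in> to_circle -` U"
    using assms x by (auto simp: open_circle_def)
  then obtain e where e: "e > 0" "\<And>y. dist y x < e \<Longrightarrow> to_circle y \<in> U"
    unfolding open_dist by auto
  have "c + d \<in> U" if "cnorm d < e" for d
  proof -
    obtain z where z: "to_circle z = d" "\<bar>z\<bar> = cnorm d" by (rule cnorm_representative)
    show ?thesis using e(2)[of "x + z"] z x that by (simp add: dist_real_def to_circle_add)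
  qed
  with e(1) that show ?thesis by blast
qed

section \<open>Doubling\<close>

definition double :: "nat \<Rightarrow> 'a::ab_group_add \<Rightarrow> 'a" where
  "double i = (\<lambda>x. x + x) ^^ i"

lemma double_0 [simp]: "double 0 x = x"
  and double_Suc: "double (Suc i) x = double i x + double i x"
  by (simp_all add: double_def)

lemma additive_double:
  assumes "Modules.additive f"
  shows "f (double i x) = double i (f x)"
  by (induction i) (simp_all add: double_Suc additive.add[OF assms])

text \<open>A point of the circle whose first multiples by powers of two all stay in a short arc is
  itself close to zero, because doubling is exact there.\<close>

lemma cnorm_le_of_doubles:
  assumes "e \<le> 1 / 4" "\<And>i. i \<le> j \<Longrightarrow> cnorm (double i c) \<le> e"
  shows "cnorm c \<le> e / 2 ^ j"
proof -
  have "cnorm (double i c) = 2 ^ i * cnorm c" if "i \<le> j" for i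
    using that
  proof (induction i)
    case (Suc i)
    then have "cnorm (double i c) \<le> 1 / 4" using assms(2)[of i] assms(1) by simp
    then show ?case using Suc by (simp add: double_Suc cnorm_double)
  qed simp
  then have "2 ^ j * cnorm c \<le> e" using assms(2)[of j] by simp
  then show ?thesis by (simp add: field_simps)
qed

text \<open>The circle has no small subgroups.\<close>

lemma additive_eq_0:
  assumes f: "Modules.additive f" and small: "\<And>x. cnorm (f x) \<le> 1 / 4"
  shows "f x = 0"
proof -
  have le: "cnorm (f x) \<le> (1 / 4) / 2 ^ j" for j
    by (rule cnorm_le_of_doubles) (simp_all only: small order_refl flip: additive_double[OF f])
  have "(\<lambda>j. (1 / 4) / 2 ^ j :: real) \<longlonglongrightarrow> 0"
    by (rule LIMSEQ_divide_realpow_zero) simp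
  then have "cnorm (f x) \<le> 0"
    by (rule tendsto_lowerbound) (use le in auto)
  then show ?thesis by (metis cnorm_eq_0D cnorm_nonneg order_antisym)
qed


section \<open>Group topologies given by a sequence of neighbourhoods of zero\<close>

definition nbhd_topology :: "(nat \<Rightarrow> 'a::ab_group_add set) \<Rightarrow> 'a topology" where
  "nbhd_topology V = topology (\<lambda>U. \<forall>x\<in>U. \<exists>n. \<forall>v\<in>V n. x + v \<in> U)"

locale nbhd_sequence =
  fixes V :: "nat \<Rightarrow> 'a::ab_group_add set"
  assumes zero: "0 \<in> V n"
    and minus: "x \<in> V n \<Longrightarrow> - x \<in> V n"
    and add: "x \<in> V (Suc n) \<Longrightarrow> y \<in> V (Suc n) \<Longrightarrow> x + y \<in> V n"
    and separated: "(\<And>n. x \<in> V n) \<Longrightarrow> x = 0"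
begin

lemma diff: "x \<in> V (Suc n) \<Longrightarrow> y \<in> V (Suc n) \<Longrightarrow> x - y \<in> V n"
  using add[of x n "- y"] minus[of y] by simp

lemma antimono: "m \<le> n \<Longrightarrow> x \<in> V n \<Longrightarrow> x \<in> V m"
  by (induction n rule: dec_induct) (use add[OF _ zero] in auto)

lemma openin_nbhd: "openin (nbhd_topology V) U \<longleftrightarrow> (\<forall>x\<in>U. \<exists>n. \<forall>v\<in>V n. x + v \<in> U)"
proof -
  have "istopology (\<lambda>U. \<forall>x\<in>U. \<exists>n. \<forall>v\<in>V n. x + v \<in> U)"
    unfolding istopology_def
  proof (intro conjI allI impI ballI)
    fix S T x assume *: "\<forall>x\<in>S. \<exists>n. \<forall>v\<in>V n. x + v \<in> S" "\<forall>x\<in>T. \<exists>n. \<forall>v\<in>V n. x + v \<in> T" "x \<in> S \<inter> T"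
    then obtain m n where "\<forall>v\<in>V m. x + v \<in> S" "\<forall>v\<in>V n. x + v \<in> T" by blast
    then have "\<forall>v\<in>V (max m n). x + v \<in> S \<inter> T"
      using antimono[of m "max m n"] antimono[of n "max m n"] by auto
    then show "\<exists>n. \<forall>v\<in>V n. x + v \<in> S \<inter> T" ..
  qed fast
  then show ?thesis unfolding nbhd_topology_def by simp
qed

lemma topspace_nbhd: "topspace (nbhd_topology V) = UNIV"
  using openin_subset[of "nbhd_topology V" UNIV] by (auto simp: openin_nbhd)

lemma open_inside_nbhd:
  obtains A where "openin (nbhd_topology V) A" "x \<in> A" "\<And>y. y \<in> A \<Longrightarrow> y - x \<in> V n"
proof -
  define A where "A = {y. \<exists>m. \<forall>v\<in>V m. y + v - x \<in> V n}"
  have "openin (nbhd_topology V) A"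
    unfolding openin_nbhd
  proof
    fix y assume "y \<in> A"
    then obtain m where m: "\<And>v. v \<in> V m \<Longrightarrow> y + v - x \<in> V n" by (auto simp: A_def)
    have "y + w \<in> A" if "w \<in> V (Suc m)" for w
    proof -
      have "y + w + v - x \<in> V n" if "v \<in> V (Suc m)" for v
        using m[OF add[OF \<open>w \<in> V (Suc m)\<close> that]] by (simp add: algebra_simps)
      then show ?thesis by (auto simp: A_def)
    qed
    then show "\<exists>n. \<forall>v\<in>V n. y + v \<in> A" by blast
  qed
  moreover have "x \<in> A" by (auto simp: A_def)
  moreover have "y - x \<in> V n" if "y \<in> A" for y
    using that zero by (force simp: A_def)
  ultimately show ?thesis using that by blast
qed

lemma group_topology_nbhd: "group_topology (nbhd_topology V)"
proof -
  let ?T = "nbhd_topology V"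
  have "continuous_map (prod_topology ?T ?T) ?T (\<lambda>(x, y). x + y)"
    unfolding continuous_map_def
  proof (intro conjI allI impI)
    fix U assume U: "openin ?T U"
    show "openin (prod_topology ?T ?T) {p \<in> topspace (prod_topology ?T ?T). (case p of (x, y) \<Rightarrow> x + y) \<in> U}"
      unfolding openin_prod_topology_alt
    proof (intro allI impI)
      fix x y assume "(x, y) \<in> {p \<in> topspace (prod_topology ?T ?T). (case p of (x, y) \<Rightarrow> x + y) \<in> U}"
      then have "x + y \<in> U" by simp
      then obtain n where n: "\<And>v. v \<in> V n \<Longrightarrow> x + y + v \<in> U"
        using U unfolding openin_nbhd by blast
      obtain A where A: "openin ?T A" "x \<in> A" "\<And>a. a \<in> A \<Longrightarrow> a - x \<in> V (Suc n)"
        by (rule open_inside_nbhd[of x "Suc n"]) blast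
      obtain B where B: "openin ?T B" "y \<in> B" "\<And>b. b \<in> B \<Longrightarrow> b - y \<in> V (Suc n)"
        by (rule open_inside_nbhd[of y "Suc n"]) blast
      have "a + b \<in> U" if "a \<in> A" "b \<in> B" for a b
        using n[OF add[OF A(3)[OF that(1)] B(3)[OF that(2)]]] by (simp add: algebra_simps)
      then show "\<exists>A B. openin ?T A \<and> openin ?T B \<and> x \<in> A \<and> y \<in> B \<and>
          A \<times> B \<subseteq> {p \<in> topspace (prod_topology ?T ?T). (case p of (x, y) \<Rightarrow> x + y) \<in> U}"
        using A(1,2) B(1,2)
        by (intro exI[of _ A] exI[of _ B]) (auto simp: topspace_nbhd)
    qed
  qed (auto simp: topspace_nbhd)
  moreover have "continuous_map ?T ?T uminus"
    unfolding continuous_map_def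
  proof (intro conjI allI impI)
    fix U assume U: "openin ?T U"
    show "openin ?T {x \<in> topspace ?T. - x \<in> U}"
      unfolding openin_nbhd
    proof
      fix x assume "x \<in> {x \<in> topspace ?T. - x \<in> U}"
      then have "- x \<in> U" by simp
      then obtain n where n: "\<And>v. v \<in> V n \<Longrightarrow> - x + v \<in> U"
        using U unfolding openin_nbhd by blast
      have "- (x + v) \<in> U" if "v \<in> V n" for v
        using n[OF minus[OF that]] by (simp add: algebra_simps)
      then show "\<exists>n. \<forall>v\<in>V n. x + v \<in> {x \<in> topspace ?T. - x \<in> U}"
        by (auto simp: topspace_nbhd)
    qed
  qed (auto simp: topspace_nbhd)
  moreover have "Hausdorff_space ?T"
    unfolding Hausdorff_space_def
  proof (intro allI impI)
    fix x y assume "x \<in> topspace ?T \<and> y \<in> topspace ?T \<and> x \<noteq> y"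
    then obtain n where n: "x - y \<notin> V n" using separated[of "x - y"] by auto
    obtain A where A: "openin ?T A" "x \<in> A" "\<And>a. a \<in> A \<Longrightarrow> a - x \<in> V (Suc n)"
      by (rule open_inside_nbhd[of x "Suc n"]) blast
    obtain B where B: "openin ?T B" "y \<in> B" "\<And>b. b \<in> B \<Longrightarrow> b - y \<in> V (Suc n)"
      by (rule open_inside_nbhd[of y "Suc n"]) blast
    have "disjnt A B"
      unfolding disjnt_iff
    proof (intro allI notI)
      fix z assume "z \<in> A \<and> z \<in> B"
      then have "(z - y) - (z - x) \<in> V n" using A(3) B(3) by (blast intro: diff)
      then show False using n by simp
    qed
    then show "\<exists>U W. openin ?T U \<and> openin ?T W \<and> x \<in> U \<and> y \<in> W \<and> disjnt U W"
      using A B by blast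
  qed
  ultimately show ?thesis by (simp add: group_topology_def topspace_nbhd)
qed

lemma continuous_character_iff:
  assumes f: "Modules.additive f"
  shows "continuous_map (nbhd_topology V) euclidean f
    \<longleftrightarrow> (\<forall>e>0. \<exists>n. \<forall>v\<in>V n. cnorm (f v) < e)"
proof
  assume c: "continuous_map (nbhd_topology V) euclidean f"
  show "\<forall>e>0. \<exists>n. \<forall>v\<in>V n. cnorm (f v) < e"
  proof (intro allI impI)
    fix e :: real assume e: "e > 0"
    have "openin (nbhd_topology V) {x. cnorm (f x) < e}"
      using openin_continuous_map_preimage[OF c, of "{d. cnorm (d - 0) < e}"] open_cnorm_ball[of 0 e]
      by (simp add: topspace_nbhd)
    moreover have "0 \<in> {x. cnorm (f x) < e}" using e by (simp add: additive.zero[OF f])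
    ultimately show "\<exists>n. \<forall>v\<in>V n. cnorm (f v) < e" unfolding openin_nbhd by force
  qed
next
  assume small: "\<forall>e>0. \<exists>n. \<forall>v\<in>V n. cnorm (f v) < e"
  show "continuous_map (nbhd_topology V) euclidean f"
    unfolding continuous_map_def
  proof (intro conjI allI impI)
    fix U :: "circle set" assume U: "openin euclidean U"
    show "openin (nbhd_topology V) {x \<in> topspace (nbhd_topology V). f x \<in> U}"
      unfolding openin_nbhd
    proof
      fix x assume "x \<in> {x \<in> topspace (nbhd_topology V). f x \<in> U}"
      then obtain e where e: "e > 0" "\<And>d. cnorm d < e \<Longrightarrow> f x + d \<in> U"
        using open_circle_contains_ball[of U "f x"] U by auto
      then obtain n where "\<forall>v\<in>V n. cnorm (f v) < e" using small by blast
      then show "\<exists>n. \<forall>v\<in>V n. x + v \<in> {x \<in> topspace (nbhd_topology V). f x \<in> U}"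
        using e(2) by (auto simp: additive.add[OF f] topspace_nbhd)
    qed
  qed auto
qed

lemma finer_nbhd_topology:
  assumes W: "nbhd_sequence W" and sub: "\<And>n. W n \<subseteq> V n"
  shows "finer_topology (nbhd_topology W) (nbhd_topology V)"
  unfolding finer_topology_def openin_nbhd nbhd_sequence.openin_nbhd[OF W] using sub by blast

end

text \<open>Continuity of addition and negation at zero lets any neighbourhood be halved symmetrically.
  A metric enters only through the countable base of balls around zero.\<close>

lemma metrizable_group_nbhd_sequence:
  fixes T :: "'a::ab_group_add topology"
  assumes T: "group_topology T" and "metrizable_space T"
  obtains V where "nbhd_sequence V" "nbhd_topology V = T" "V 0 = UNIV"
proof -
  have top: "topspace T = UNIV" and plus: "continuous_map (prod_topology T T) T (\<lambda>(x, y). x + y)"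
    and neg: "continuous_map T T uminus" and haus: "Hausdorff_space T"
    using T by (auto simp: group_topology_def)
  obtain M d where M: "Metric_space M d" "T = Metric_space.mtopology M d"
    using \<open>metrizable_space T\<close> unfolding metrizable_space_def by blast
  interpret Metric_space M d by fact
  define B where "B n = mball 0 (1 / Suc n)" for n
  have M_UNIV: "M = UNIV" using M(2) top by simp
  have B: "openin T (B n)" "0 \<in> B n" for n
    unfolding B_def M(2) by (simp_all only: openin_mball centre_in_mball_iff) (simp add: M_UNIV)
  have B_base: "\<exists>n. B n \<subseteq> U" if "openin T U" "0 \<in> U" for U
  proof -
    obtain r where r: "r > 0" "mball 0 r \<subseteq> U" using \<open>openin T U\<close> \<open>0 \<in> U\<close> M(2) by (auto simp: openin_mtopology)
    then obtain n where "1 / Suc n < r" using nat_approx_posE by blast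
    then show ?thesis using r(2) mball_subset_concentric[of "1 / Suc n" r 0] by (force simp: B_def)
  qed
  have shrink: "\<exists>X'. openin T X' \<and> 0 \<in> X' \<and> (\<forall>x\<in>X'. - x \<in> X') \<and> X' \<subseteq> B n \<and> (\<forall>x\<in>X'. \<forall>y\<in>X'. x + y \<in> X)"
    if X: "openin T X" "0 \<in> X" for X n
  proof -
    have "openin (prod_topology T T) {p \<in> topspace (prod_topology T T). (case p of (x, y) \<Rightarrow> x + y) \<in> X}"
      (is "openin _ ?S")
      using openin_continuous_map_preimage[OF plus X(1)] .
    moreover have "(0, 0) \<in> ?S" using X(2) top by simp
    ultimately obtain P Q where PQ: "openin T P" "openin T Q" "0 \<in> P" "0 \<in> Q"
        "P \<times> Q \<subseteq> {p \<in> topspace (prod_topology T T). (case p of (x, y) \<Rightarrow> x + y) \<in> X}"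
      unfolding openin_prod_topology_alt by meson
    define Y where "Y = P \<inter> Q \<inter> B n"
    have Y: "openin T Y" "0 \<in> Y" using PQ B by (auto simp: Y_def)
    have "openin T {x \<in> topspace T. - x \<in> Y}" using openin_continuous_map_preimage[OF neg Y(1)] .
    then have "openin T (Y \<inter> {x. - x \<in> Y})" using Y top by auto
    then show ?thesis using Y PQ(5)
      by (intro exI[of _ "Y \<inter> {x. - x \<in> Y}"]) (auto simp: Y_def)
  qed
  have "\<exists>V. \<forall>n. (openin T (V n) \<and> 0 \<in> V n \<and> (\<forall>x\<in>V n. - x \<in> V n) \<and> (n = 0 \<longrightarrow> V n = UNIV))
      \<and> (V (Suc n) \<subseteq> B n \<and> (\<forall>x\<in>V (Suc n). \<forall>y\<in>V (Suc n). x + y \<in> V n))"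
  proof (rule dependent_nat_choice)
    show "\<exists>X. openin T X \<and> 0 \<in> X \<and> (\<forall>x\<in>X. - x \<in> X) \<and> (0 = 0 \<longrightarrow> X = UNIV)"
      using top openin_topspace[of T] by auto
  next
    fix X and n :: nat assume "openin T X \<and> 0 \<in> X \<and> (\<forall>x\<in>X. - x \<in> X) \<and> (n = 0 \<longrightarrow> X = UNIV)"
    then show "\<exists>Y. (openin T Y \<and> 0 \<in> Y \<and> (\<forall>x\<in>Y. - x \<in> Y) \<and> (Suc n = 0 \<longrightarrow> Y = UNIV)) \<and>
        Y \<subseteq> B n \<and> (\<forall>x\<in>Y. \<forall>y\<in>Y. x + y \<in> X)"
      using shrink[of X n] by (metis Zero_not_Suc)
  qed
  then obtain V where V: "\<And>n. openin T (V n)" "\<And>n. 0 \<in> V n" "\<And>n x. x \<in> V n \<Longrightarrow> - x \<in> V n"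
      "V 0 = UNIV" "\<And>n. V (Suc n) \<subseteq> B n"
      "\<And>n x y. x \<in> V (Suc n) \<Longrightarrow> y \<in> V (Suc n) \<Longrightarrow> x + y \<in> V n"
    by metis
  have base: "\<exists>n. V n \<subseteq> U" if "openin T U" "0 \<in> U" for U
    using B_base[OF that] V(5) by blast
  have translate: "openin T {v. x + v \<in> U}" if "openin T U" for x U
  proof -
    have "continuous_map T (prod_topology T T) (\<lambda>v. (x, v))"
      by (simp add: continuous_map_pairwise o_def top)
    then have "continuous_map T T ((\<lambda>(x, y). x + y) \<circ> (\<lambda>v. (x, v)))"
      by (rule continuous_map_compose[OF _ plus])
    from openin_continuous_map_preimage[OF this that] show ?thesis by (simp add: top)
  qed
  have seq: "nbhd_sequence V"
  proof
    fix x assume x: "\<And>n. x \<in> V n"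
    show "x = 0"
    proof (rule ccontr)
      assume "x \<noteq> 0"
      then obtain U where "openin T U" "0 \<in> U" "x \<notin> U"
        using haus top unfolding Hausdorff_space_def disjnt_iff by (metis UNIV_I)
      then show False using base x by blast
    qed
  qed (use V in auto)
  interpret nbhd_sequence V by fact
  have "openin (nbhd_topology V) U = openin T U" for U
  proof
    assume U: "openin T U"
    show "openin (nbhd_topology V) U"
      unfolding openin_nbhd
    proof
      fix x assume "x \<in> U"
      then show "\<exists>n. \<forall>v\<in>V n. x + v \<in> U" using base[OF translate[OF U, of x]] by auto
    qed
  next
    assume U: "openin (nbhd_topology V) U"
    show "openin T U"
      unfolding openin_subopen[of T U]
    proof
      fix x assume "x \<in> U"
      then obtain n where n: "\<forall>v\<in>V n. x + v \<in> U" using U openin_nbhd by blast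
      have "openin T {y. - x + y \<in> V n}" using translate[OF V(1)] .
      moreover have "x \<in> {y. - x + y \<in> V n}" using V(2) by simp
      moreover have "{y. - x + y \<in> V n} \<subseteq> U"
      proof
        fix y assume "y \<in> {y. - x + y \<in> V n}"
        then show "y \<in> U" using n by (metis add_minus_cancel mem_Collect_eq)
      qed
      ultimately show "\<exists>A. openin T A \<and> x \<in> A \<and> A \<subseteq> U" by blast
    qed
  qed
  then have "nbhd_topology V = T" by (simp add: topology_eq)
  with seq V(4) that show ?thesis by blast
qed


section \<open>Finite sets that detect continuity of characters\<close>

context nbhd_sequence
begin

lemma double_in:
  assumes "x \<in> V (n + i)"
  shows "double i x \<in> V n"
  using assms by (induction i arbitrary: n) (auto simp: double_Suc intro!: add)

text \<open>Precompactness covers \<open>V n\<close> by translates with arbitrary centres; replacing each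
  centre by a point of \<open>V n\<close> in its translate costs one halving.\<close>

lemma precompact_finite_net:
  assumes "precompact_topology (nbhd_topology V)"
  obtains K where "finite K" "K \<subseteq> V n" "\<And>g. g \<in> V n \<Longrightarrow> \<exists>k\<in>K. g - k \<in> V m"
proof -
  obtain A where "openin (nbhd_topology V) A" "0 \<in> A" "A \<subseteq> V (Suc m)"
    by (rule open_inside_nbhd[of 0 "Suc m"]) auto
  then obtain F where F: "finite F" "F + V (Suc m) = UNIV"
    using assms unfolding precompact_topology_def by meson
  define near where "near f g \<longleftrightarrow> g \<in> V n \<and> g - f \<in> V (Suc m)" for f g
  define K where "K = (\<lambda>f. SOME g. near f g) ` {f \<in> F. \<exists>g. near f g}"
  have some: "near f (SOME g. near f g)" if "near f g" for f g
    using that by (rule someI)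
  have "K \<subseteq> V n" using some by (auto simp: K_def near_def)
  moreover have "\<exists>k\<in>K. g - k \<in> V m" if g: "g \<in> V n" for g
  proof -
    obtain f v where "f \<in> F" "v \<in> V (Suc m)" "g = f + v"
      using F(2) by (metis UNIV_I set_plus_elim)
    then have f: "f \<in> F" "near f g" using g by (auto simp: near_def)
    let ?k = "SOME g. near f g"
    have "(g - f) - (?k - f) \<in> V m"
      using some[OF f(2)] f(2) unfolding near_def by (blast intro: diff)
    moreover have "?k \<in> K" using f by (auto simp: K_def)
    ultimately show ?thesis by auto
  qed
  moreover have "finite K" using F(1) by (simp add: K_def)
  ultimately show ?thesis using that by blast
qed

text \<open>In the expansion \<open>g = d\<^sub>N + d\<^sub>N\<^sub>+\<^sub>1 + \<dots>\<close> of an element of \<open>V (2 N)\<close> into digits, the term \<open>d\<^sub>j\<close>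
  lies in \<open>V (2 j)\<close>. The factor two leaves room for doubling it \<open>j\<close> times without leaving \<open>V j\<close>.\<close>

lemma detecting_sets:
  assumes precompact: "precompact_topology (nbhd_topology V)" and "countable (UNIV :: 'a set)"
  obtains E :: "nat \<Rightarrow> 'a set" where
    "\<And>j. finite (E j)" "\<And>j. E j \<subseteq> V j" "\<And>j x. x \<in> E j \<Longrightarrow> - x \<in> E j"
    "\<And>f N g. Modules.additive f \<Longrightarrow> (\<And>j u. N \<le> j \<Longrightarrow> u \<in> E j \<Longrightarrow> cnorm (f u) \<le> 1 / 8)
      \<Longrightarrow> g \<in> V (2 * N) \<Longrightarrow> cnorm (f g) \<le> (1 / 4) / 2 ^ N"
proof -
  obtain e :: "nat \<Rightarrow> 'a" where e: "range e = UNIV"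
    using \<open>countable UNIV\<close> by (metis UNIV_not_empty range_from_nat_into)
  have "\<exists>K. finite K \<and> K \<subseteq> V (2 * j) \<and> (\<forall>g\<in>V (2 * j). \<exists>k\<in>K. g - k \<in> V (2 * Suc j))" for j
    by (rule precompact_finite_net[OF precompact, of "2 * j" "2 * Suc j"]) blast
  then obtain K where K: "\<And>j. finite (K j)" "\<And>j. K j \<subseteq> V (2 * j)"
      "\<And>j g. g \<in> V (2 * j) \<Longrightarrow> \<exists>k\<in>K j. g - k \<in> V (2 * Suc j)"
    by metis
  then have "\<forall>j g. \<exists>k. g \<in> V (2 * j) \<longrightarrow> k \<in> K j \<and> g - k \<in> V (2 * Suc j)" by blast
  then obtain digit where digit: "\<And>j g. g \<in> V (2 * j) \<Longrightarrow> digit j g \<in> K j"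
      "\<And>j g. g \<in> V (2 * j) \<Longrightarrow> g - digit j g \<in> V (2 * Suc j)"
    by metis
  define remainder where
    "remainder N g = rec_nat g (\<lambda>d r. r - digit (N + d) r)" for N g
  have rem_0: "remainder N g 0 = g" and
    rem_Suc: "remainder N g (Suc d) = remainder N g d - digit (N + d) (remainder N g d)" for N g d
    by (simp_all add: remainder_def)
  have rem_in: "remainder N g d \<in> V (2 * (N + d))" if "g \<in> V (2 * N)" for N g d
    by (induction d) (use that digit(2)[of _ "N + _"] in \<open>auto simp: rem_0 rem_Suc\<close>)
  \<comment> \<open>Besides the digits, \<open>F j\<close> contains the remainders at stage \<open>j\<close> of the first elements of the
    group, so the expansion of \<open>e k\<close> can be stopped with its \<open>k\<close>-th remainder as last summand.\<close>
  define F where "F j = K j \<union>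
    (\<lambda>(N, k). remainder N (e k) (j - N)) ` {(N, k) \<in> {..j} \<times> {..j}. e k \<in> V (2 * N)}" for j
  have F_fin: "finite (F j)" for j
  proof -
    have "finite {(N, k) \<in> {..j} \<times> {..j}. e k \<in> V (2 * N)}"
      by (rule finite_subset[of _ "{..j} \<times> {..j}"]) auto
    then show ?thesis using K(1) by (simp add: F_def)
  qed
  have F_sub: "F j \<subseteq> V (2 * j)" for j
  proof
    fix x assume "x \<in> F j"
    then consider "x \<in> K j" | N k where "N \<le> j" "e k \<in> V (2 * N)" "x = remainder N (e k) (j - N)"
      by (auto simp: F_def)
    then show "x \<in> V (2 * j)"
    proof cases
      case (2 N k)
      then show ?thesis using rem_in[of "e k" N "j - N"] by simp
    qed (use K(2) in auto)
  qed
  define D where "D j = (\<Union>i\<le>j. double i ` F j)" for j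
  define E where "E j = D j \<union> uminus ` D j" for j
  have E_sub: "E j \<subseteq> V j" for j
  proof -
    have "double i x \<in> V j" if "i \<le> j" "x \<in> F j" for i x
      using that F_sub antimono[of "j + i" "2 * j" x] by (intro double_in) auto
    then show ?thesis using minus by (auto simp: E_def D_def)
  qed
  have E_detects: "cnorm (f g) \<le> (1 / 4) / 2 ^ N"
    if f: "Modules.additive f" and small: "\<And>j u. N \<le> j \<Longrightarrow> u \<in> E j \<Longrightarrow> cnorm (f u) \<le> 1 / 8"
      and g: "g \<in> V (2 * N)" for f N g
  proof -
    have F_small: "cnorm (f x) \<le> (1 / 8) / 2 ^ j" if "N \<le> j" "x \<in> F j" for j x
    proof (rule cnorm_le_of_doubles)
      fix i assume "i \<le> j"
      then have "double i x \<in> E j" using that by (auto simp: E_def D_def)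
      then show "cnorm (double i (f x)) \<le> 1 / 8"
        using small[OF \<open>N \<le> j\<close>] by (simp flip: additive_double[OF f])
    qed simp
    \<comment> \<open>The difference of the two powers is the sum of the bounds for the first \<open>d\<close> digits.\<close>
    have partial: "cnorm (f g) \<le> (1 / 4) / 2 ^ N - (1 / 4) / 2 ^ (N + d) + cnorm (f (remainder N g d))" for d
    proof (induction d)
      case (Suc d)
      let ?r = "remainder N g d"
      have "digit (N + d) ?r \<in> F (N + d)" using digit(1)[OF rem_in[OF g]] by (simp add: F_def)
      then have "cnorm (f (digit (N + d) ?r)) \<le> (1 / 8) / 2 ^ (N + d)" by (intro F_small) auto
      moreover have "cnorm (f ?r) \<le> cnorm (f (remainder N g (Suc d))) + cnorm (f (digit (N + d) ?r))"
        using cnorm_triangle[of "f (remainder N g (Suc d))" "f (digit (N + d) ?r)"]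
        by (simp add: rem_Suc flip: additive.add[OF f])
      moreover have "(1 / 4) / 2 ^ (N + Suc d) = (1 / 8) / (2 ^ (N + d) :: real)" by simp
      moreover have "(1 / 4) / 2 ^ (N + d) = 2 * ((1 / 8) / (2 ^ (N + d) :: real))" by simp
      ultimately show ?case using Suc.IH by linarith
    qed (simp add: rem_0)
    obtain k where k: "g = e k" using e by (metis UNIV_I image_iff)
    have "remainder N g k \<in> F (N + k)"
      unfolding F_def by (intro UnI2 image_eqI[where x = "(N, k)"]) (use g k in simp_all)
    then have "cnorm (f (remainder N g k)) \<le> (1 / 8) / 2 ^ (N + k)" by (intro F_small) auto
    also have "\<dots> \<le> (1 / 4) / 2 ^ (N + k)" by (intro divide_right_mono) auto
    finally show ?thesis using partial[of k] by simp
  qed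
  show ?thesis
  proof (rule that[of E])
    show "finite (E j)" for j using F_fin by (simp add: E_def D_def)
    show "- x \<in> E j" if "x \<in> E j" for x j using that by (auto simp: E_def)
  qed (fact E_sub, rule E_detects)
qed

end

section \<open>Sums of null sequences\<close>

context nbhd_sequence
begin

text \<open>Nowhere density, in the form that produces a null sequence of points which avoid the given
  sets together with a whole neighbourhood.\<close>

definition nowhere_dense :: "'a set \<Rightarrow> bool" where
  "nowhere_dense S \<longleftrightarrow> (\<forall>g i. \<exists>h j. \<forall>v\<in>V j. h + v \<in> V i \<and> g + h + v \<notin> S)"

lemma nowhere_denseE:
  assumes "nowhere_dense S"
  obtains h j where "\<And>v. v \<in> V j \<Longrightarrow> h + v \<in> V i" "\<And>v. v \<in> V j \<Longrightarrow> g + h + v \<notin> S"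
  using assms unfolding nowhere_dense_def by meson

lemma nowhere_dense_Un:
  assumes "nowhere_dense S" "nowhere_dense S'"
  shows "nowhere_dense (S \<union> S')"
  unfolding nowhere_dense_def
proof (intro allI)
  fix g i
  obtain h j where h: "\<And>v. v \<in> V j \<Longrightarrow> h + v \<in> V i" "\<And>v. v \<in> V j \<Longrightarrow> g + h + v \<notin> S"
    by (rule nowhere_denseE[OF assms(1)]) blast
  obtain h' j' where h': "\<And>v. v \<in> V j' \<Longrightarrow> h' + v \<in> V j" "\<And>v. v \<in> V j' \<Longrightarrow> g + h + h' + v \<notin> S'"
    by (rule nowhere_denseE[OF assms(2)]) blast
  have "h + h' + v \<in> V i \<and> g + (h + h') + v \<notin> S \<union> S'" if "v \<in> V j'" for v
    using h[OF h'(1)[OF that]] h'(2)[OF that] by (simp add: algebra_simps)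
  then show "\<exists>h j. \<forall>v\<in>V j. h + v \<in> V i \<and> g + h + v \<notin> S \<union> S'" by blast
qed

lemma nowhere_dense_translate:
  assumes "nowhere_dense S"
  shows "nowhere_dense (S + {a})"
  unfolding nowhere_dense_def
proof (intro allI)
  fix g i
  obtain h j where h: "\<And>v. v \<in> V j \<Longrightarrow> h + v \<in> V i" "\<And>v. v \<in> V j \<Longrightarrow> (g - a) + h + v \<notin> S"
    by (rule nowhere_denseE[OF assms]) blast
  have "g + h + v \<notin> S + {a}" if v: "v \<in> V j" for v
  proof
    assume "g + h + v \<in> S + {a}"
    then obtain s where "s \<in> S" "g + h + v = s + a" by (auto elim!: set_plus_elim)
    then show False using h(2)[OF v] by (simp add: algebra_simps)
  qed
  with h(1) show "\<exists>h j. \<forall>v\<in>V j. h + v \<in> V i \<and> g + h + v \<notin> S + {a}" by blast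
qed

lemma nowhere_dense_empty: "nowhere_dense {}"
  unfolding nowhere_dense_def by (metis add_0 empty_iff)

lemma nowhere_dense_plus_finite:
  assumes "nowhere_dense S" "finite F"
  shows "nowhere_dense (S + F)"
  using assms(2)
proof (induction F)
  case (insert a F)
  have "S + insert a F = (S + {a}) \<union> (S + F)" by (metis insert_is_Un set_plus_Un)
  then show ?case using insert assms(1) by (simp add: nowhere_dense_Un nowhere_dense_translate)
qed (simp add: nowhere_dense_empty)

text \<open>An infinite precompact group has no isolated points: finitely many translates of a finite
  neighbourhood of zero would cover it.\<close>

lemma nowhere_dense_zero:
  assumes precompact: "precompact_topology (nbhd_topology V)" and "infinite (UNIV :: 'a set)"
  shows "nowhere_dense {0}"
  unfolding nowhere_dense_def
proof (intro allI)
  fix g :: 'a and i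
  have "\<exists>h\<in>V (Suc i). g + h \<noteq> 0"
  proof (rule ccontr)
    assume "\<not> ?thesis"
    then have "V (Suc i) \<subseteq> {- g}" using add_eq_0_iff by auto
    moreover obtain A where "openin (nbhd_topology V) A" "0 \<in> A" "A \<subseteq> V (Suc i)"
      by (rule open_inside_nbhd[of 0 "Suc i"]) auto
    then obtain F where F: "finite F" "F + V (Suc i) = UNIV"
      using precompact unfolding precompact_topology_def by meson
    ultimately show False
      using finite_set_plus[of F "V (Suc i)"] \<open>infinite UNIV\<close> by (metis finite.emptyI finite.insertI finite_subset)
  qed
  then obtain h where h: "h \<in> V (Suc i)" "g + h \<noteq> 0" by blast
  then obtain j where j: "- (g + h) \<notin> V j" using separated by (metis neg_equal_0_iff_equal)
  have "h + v \<in> V i \<and> g + h + v \<notin> {0}" if "v \<in> V (max j (Suc i))" for v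
  proof -
    have "v \<in> V j" "v \<in> V (Suc i)" using that antimono[of _ "max j (Suc i)" v] by auto
    moreover from this(1) j have "g + h + v \<noteq> 0" by (metis minus_unique)
    ultimately show ?thesis using h(1) by (simp add: add)
  qed
  then show "\<exists>h j. \<forall>v\<in>V j. h + v \<in> V i \<and> g + h + v \<notin> {0}" by blast
qed

text \<open>The far part of the null sequence \<open>A\<close> is absorbed by a smaller neighbourhood, and the
  remaining terms contribute finitely many translates.\<close>

lemma nowhere_dense_plus_null:
  assumes S: "nowhere_dense S" and null: "\<And>n. finite (A - V n)"
  shows "nowhere_dense (S + A)"
  unfolding nowhere_dense_def
proof (intro allI)
  fix g i
  obtain h j where h: "\<And>v. v \<in> V j \<Longrightarrow> h + v \<in> V i" "\<And>v. v \<in> V j \<Longrightarrow> g + h + v \<notin> S"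
    by (rule nowhere_denseE[OF S]) blast
  obtain h' j' where h': "\<And>v. v \<in> V j' \<Longrightarrow> h' + v \<in> V (Suc j)"
      "\<And>v. v \<in> V j' \<Longrightarrow> g + h + h' + v \<notin> S + (A - V (Suc j))"
    by (rule nowhere_denseE[OF nowhere_dense_plus_finite[OF S null[of "Suc j"]]]) blast
  have "h + h' + v \<in> V i \<and> g + (h + h') + v \<notin> S + A" if v: "v \<in> V j'" for v
  proof
    have "h' + v \<in> V j" using antimono[OF _ h'(1)[OF v], of j] by simp
    then show "h + h' + v \<in> V i" using h(1)[of "h' + v"] by (simp add: algebra_simps)
    show "g + (h + h') + v \<notin> S + A"
    proof
      assume "g + (h + h') + v \<in> S + A"
      then obtain s a where sa: "s \<in> S" "a \<in> A" "g + (h + h') + v = s + a" by (auto elim!: set_plus_elim)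
      show False
      proof (cases "a \<in> V (Suc j)")
        case True
        then have "h' + v - a \<in> V j" using diff[OF h'(1)[OF v]] by simp
        moreover have "g + h + (h' + v - a) = s" using sa(3) by (simp add: algebra_simps)
        ultimately show False using h(2) sa(1) by metis
      next
        case False
        then have "s + a \<in> S + (A - V (Suc j))" using sa by blast
        then show False using h'(2)[OF v] sa(3) by (simp add: algebra_simps)
      qed
    qed
  qed
  then show "\<exists>h j. \<forall>v\<in>V j. h + v \<in> V i \<and> g + h + v \<notin> S + A" by blast
qed

lemma sum_sets_subset:
  fixes p :: "nat \<Rightarrow> nat"
  assumes "strict_mono p" "\<And>k. B k \<subseteq> V (Suc (p k))" "m \<le> n"
  shows "(\<Sum>k=m..<n. B k) \<subseteq> V (p m)"
  using \<open>m \<le> n\<close>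
proof (induction rule: inc_induct)
  case (step k)
  have "Suc (p k) \<le> p (Suc k)" using assms(1) by (simp add: strict_mono_Suc_iff Suc_leI)
  then have "(\<Sum>k=Suc k..<n. B k) \<subseteq> V (Suc (p k))" using step.IH antimono by blast
  then have "B k + (\<Sum>k=Suc k..<n. B k) \<subseteq> V (p k)"
    using assms(2)[of k] add[of _ "p k"] by (auto elim!: set_plus_elim)
  then show ?case using step.hyps by (simp add: sum.atLeast_Suc_lessThan)
qed (use zero in auto)

end


section \<open>A strictly finer topology with the same null sequence\<close>

lemma sum_sets_mono:
  fixes S T :: "nat \<Rightarrow> 'a::comm_monoid_add set"
  assumes "\<And>k. S k \<subseteq> T k"
  shows "(\<Sum>k<r. S k) \<subseteq> (\<Sum>k<r. T k)"
  by (induction r) (simp_all add: set_plus_mono2 assms)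

lemma sum_sets_mono_length:
  fixes S :: "nat \<Rightarrow> 'a::comm_monoid_add set"
  assumes "\<And>k. 0 \<in> S k" "r \<le> s"
  shows "(\<Sum>k<r. S k) \<subseteq> (\<Sum>k<s. S k)"
  using \<open>r \<le> s\<close>
proof (induction rule: dec_induct)
  case (step n)
  then show ?case using set_zero_plus2[OF assms(1)[of n], of "\<Sum>k<n. S k"] by (auto simp: add.commute)
qed simp

lemma sum_sets_minus:
  fixes S :: "nat \<Rightarrow> 'a::ab_group_add set"
  assumes "\<And>k x. x \<in> S k \<Longrightarrow> - x \<in> S k" "x \<in> (\<Sum>k<r. S k)"
  shows "- x \<in> (\<Sum>k<r. S k)"
  using assms(2)
proof (induction r arbitrary: x)
  case (Suc r)
  then obtain y z where "y \<in> (\<Sum>k<r. S k)" "z \<in> S r" "x = y + z" by (auto elim!: set_plus_elim)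
  then show ?case using Suc.IH[of y] assms(1)[of z r] set_plus_intro[of "- y" _ "- z"] by simp
qed simp

lemma sum_sets_pairs:
  fixes S :: "nat \<Rightarrow> 'a::comm_monoid_add set"
  shows "(\<Sum>k<r. S (2 * k) + S (2 * k + 1)) = (\<Sum>k<2 * r. S k)"
  by (induction r) (simp_all add: add.assoc)

context nbhd_sequence
begin

lemma escaping_sequence:
  assumes "precompact_topology (nbhd_topology V)" "infinite (UNIV :: 'a set)"
    and null: "\<And>n. finite (A - V n)"
  obtains h :: "nat \<Rightarrow> 'a" and p :: "nat \<Rightarrow> nat" where
    "strict_mono p" "\<And>q. h q \<in> V q" "\<And>q v. v \<in> V (p q) \<Longrightarrow> h q + v \<notin> (\<Sum>k<q. A)"
proof -
  have nd: "nowhere_dense (\<Sum>k<q. A)" for q :: nat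
  proof (induction q)
    case (Suc q)
    then show ?case using nowhere_dense_plus_null[OF _ null] by simp
  qed (simp add: nowhere_dense_zero[OF assms(1,2)])
  have "\<exists>h j. \<forall>v\<in>V j. h + v \<in> V q \<and> h + v \<notin> (\<Sum>k<q. A)" for q
    using nd[of q] unfolding nowhere_dense_def by (metis add_0)
  then obtain h J where hJ: "\<And>q v. v \<in> V (J q) \<Longrightarrow> h q + v \<in> V q"
      "\<And>q v. v \<in> V (J q) \<Longrightarrow> h q + v \<notin> (\<Sum>k<q. A)"
    by metis
  define p where "p k = (\<Sum>q\<le>k. Suc (J q))" for k :: nat
  have "strict_mono p" by (simp add: strict_mono_Suc_iff p_def)
  moreover have "J q \<le> p q" for q
    using member_le_sum[of q "{..q}" "\<lambda>q. Suc (J q)"] by (simp add: p_def)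
  then have "V (p q) \<subseteq> V (J q)" for q using antimono by blast
  moreover have "h q \<in> V q" for q using hJ(1)[OF zero] by simp
  ultimately show ?thesis using that hJ(2) by blast
qed

text \<open>The neighbourhoods are unions of sums of sets \<open>A (n\<^sub>1) + A (n\<^sub>2) + \<dots>\<close> for a rapidly growing
  sequence of indices. Passing to every second index halves such a neighbourhood, since then two
  summands are available for each one. Such a sum equal to \<open>h q\<close> would split into its first \<open>q\<close>
  terms and a rest that is so small that it stays in the neighbourhood of \<open>h q\<close> that contains no
  sums of \<open>q\<close> terms.\<close>

lemma strictly_finer_with_null_sets:
  fixes A :: "nat \<Rightarrow> 'a set"
  assumes "precompact_topology (nbhd_topology V)" "infinite (UNIV :: 'a set)"
    and A: "\<And>n. 0 \<in> A n" "\<And>n x. x \<in> A n \<Longrightarrow> - x \<in> A n" "\<And>n. A n \<subseteq> V n"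
      "\<And>m n. m \<le> n \<Longrightarrow> A n \<subseteq> A m" "\<And>n. finite (A 0 - A n)"
  obtains W where "nbhd_sequence W" "\<And>i. W i \<subseteq> V i" "\<And>i. \<exists>m. A m \<subseteq> W i"
    "nbhd_topology W \<noteq> nbhd_topology V"
proof -
  have null: "finite (A 0 - V n)" for n
    by (rule finite_subset[OF _ A(5)[of n]]) (use A(3) in auto)
  obtain h p where p: "strict_mono p" and h: "\<And>q. h q \<in> V q"
      "\<And>q v. v \<in> V (p q) \<Longrightarrow> h q + v \<notin> (\<Sum>k<q. A 0)"
    by (rule escaping_sequence[OF assms(1,2) null]) blast
  define S where "S i k = A (Suc (p (2 ^ i * Suc k)))" for i k
  have S0: "0 \<in> S i k" for i k using A(1) by (simp add: S_def)
  have p_mono: "p a \<le> p b" if "a \<le> b" for a b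
    using that p by (simp add: strict_mono_less_eq)
  define U where "U i = (\<Union>r. \<Sum>k<r. S i k)" for i
  have U_add: "x + y \<in> U i" if xy: "x \<in> U (Suc i)" "y \<in> U (Suc i)" for x y i
  proof -
    obtain r s where "x \<in> (\<Sum>k<r. S (Suc i) k)" "y \<in> (\<Sum>k<s. S (Suc i) k)"
      using xy unfolding U_def by blast
    then have "x \<in> (\<Sum>k<max r s. S (Suc i) k)" "y \<in> (\<Sum>k<max r s. S (Suc i) k)"
      using sum_sets_mono_length[of "S (Suc i)", OF S0] by (meson max.cobounded1 max.cobounded2 subsetD)+
    then have "x + y \<in> (\<Sum>k<max r s. S (Suc i) k) + (\<Sum>k<max r s. S (Suc i) k)" by blast
    also have "\<dots> = (\<Sum>k<max r s. S (Suc i) k + S (Suc i) k)" by (simp add: sum.distrib)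
    also have "\<dots> \<subseteq> (\<Sum>k<max r s. S i (2 * k) + S i (2 * k + 1))"
      unfolding S_def by (intro sum_sets_mono set_plus_mono2 A(4)) (simp_all add: p_mono)
    also have "\<dots> = (\<Sum>k<2 * max r s. S i k)" by (rule sum_sets_pairs)
    finally show ?thesis by (auto simp: U_def)
  qed
  have U_minus: "- x \<in> U i" if x: "x \<in> U i" for x i
  proof -
    obtain r where "x \<in> (\<Sum>k<r. S i k)" using x by (auto simp: U_def)
    then have "- x \<in> (\<Sum>k<r. S i k)" by (rule sum_sets_minus[rotated]) (simp add: S_def A(2))
    then show ?thesis by (auto simp: U_def)
  qed
  have U_zero: "0 \<in> U i" for i
  proof -
    have "0 \<in> (\<Sum>k<0. S i k)" by simp
    then show ?thesis unfolding U_def by blast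
  qed
  have U_A: "A (Suc (p (2 ^ i))) \<subseteq> U i" for i
  proof -
    have "A (Suc (p (2 ^ i))) = (\<Sum>k<1. S i k)" by (simp add: S_def)
    then show ?thesis unfolding U_def by blast
  qed
  have escape: "h q \<notin> U 0" for q
  proof
    assume "h q \<in> U 0"
    then obtain r where "h q \<in> (\<Sum>k<r. S 0 k)" by (auto simp: U_def)
    then have "h q \<in> (\<Sum>k<max r q. S 0 k)"
      using sum_sets_mono_length[of "S 0" r "max r q", OF S0] by auto
    also have "\<dots> = (\<Sum>k<q. S 0 k) + (\<Sum>k=q..<max r q. S 0 k)"
      by (simp add: lessThan_atLeast0 sum.atLeastLessThan_concat)
    finally obtain a b where ab: "a \<in> (\<Sum>k<q. S 0 k)" "b \<in> (\<Sum>k=q..<max r q. S 0 k)" "h q = a + b"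
      by (rule set_plus_elim)
    have "(\<Sum>k<q. S 0 k) \<subseteq> (\<Sum>k<q. A 0)" unfolding S_def by (intro sum_sets_mono A(4)) simp
    then have "a \<in> (\<Sum>k<q. A 0)" using ab(1) by blast
    moreover have "(\<Sum>k=q..<max r q. S 0 k) \<subseteq> V (p (Suc q))"
      using sum_sets_subset[of "\<lambda>k. p (Suc k)" "S 0" q "max r q"] p A(3)
      by (simp add: S_def strict_mono_Suc_iff)
    then have "b \<in> V (p (Suc q))" using ab(2) by blast
    then have "- b \<in> V (p q)" using antimono[OF p_mono[of q "Suc q"]] minus by simp
    ultimately show False using h(2)[of "- b" q] ab(3) by simp
  qed
  \<comment> \<open>Intersecting with \<open>V i\<close> makes the topology finer than the given one, hence Hausdorff.\<close>
  define W where "W i = U i \<inter> V i" for i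
  interpret W: nbhd_sequence W
    by standard (auto simp: W_def zero U_zero minus U_minus add U_add separated)
  have "\<exists>m. A m \<subseteq> W i" for i
  proof -
    have "A (max i (Suc (p (2 ^ i)))) \<subseteq> W i"
      using U_A[of i] A(4)[of "Suc (p (2 ^ i))" "max i (Suc (p (2 ^ i)))"]
        A(4)[of i "max i (Suc (p (2 ^ i)))"] A(3)[of i]
      by (auto simp: W_def)
    then show ?thesis ..
  qed
  moreover have "nbhd_topology W \<noteq> nbhd_topology V"
  proof
    assume eq: "nbhd_topology W = nbhd_topology V"
    obtain O' where "openin (nbhd_topology W) O'" "0 \<in> O'" "\<And>y. y \<in> O' \<Longrightarrow> y - 0 \<in> W 0"
      by (rule W.open_inside_nbhd[of 0 0]) blast
    then obtain q where "\<forall>v\<in>V q. 0 + v \<in> O'" unfolding eq openin_nbhd by blast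
    then have "h q \<in> O'" using h(1) by simp
    then have "h q \<in> W 0" using \<open>\<And>y. y \<in> O' \<Longrightarrow> y - 0 \<in> W 0\<close> by fastforce
    then show False using escape by (simp add: W_def)
  qed
  moreover have "W i \<subseteq> V i" for i by (simp add: W_def)
  ultimately show ?thesis using that W.nbhd_sequence_axioms by blast
qed

end

section \<open>Discrete dual groups\<close>

context nbhd_sequence
begin

lemma compactin_null:
  assumes "0 \<in> A" and null: "\<And>n. finite (A - V n)"
  shows "compactin (nbhd_topology V) A"
  unfolding compactin_def
proof (intro conjI allI impI)
  fix \<U> assume U: "(\<forall>U\<in>\<U>. openin (nbhd_topology V) U) \<and> A \<subseteq> \<Union>\<U>"
  then obtain U0 where U0: "U0 \<in> \<U>" "0 \<in> U0" using \<open>0 \<in> A\<close> by blast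
  then obtain n where n: "\<forall>v\<in>V n. 0 + v \<in> U0" using U unfolding openin_nbhd by blast
  have "\<forall>a\<in>A. \<exists>C. C \<in> \<U> \<and> a \<in> C" using U by blast
  from bchoice[OF this] obtain c where c: "\<And>a. a \<in> A \<Longrightarrow> c a \<in> \<U> \<and> a \<in> c a" by blast
  have "A \<subseteq> \<Union> (insert U0 (c ` (A - V n)))" using c n by auto
  then show "\<exists>\<F>. finite \<F> \<and> \<F> \<subseteq> \<U> \<and> A \<subseteq> \<Union>\<F>"
    using U0(1) c null by (intro exI[of _ "insert U0 (c ` (A - V n))"]) auto
qed (simp add: topspace_nbhd)

text \<open>A character \<open>x\<close> is isolated by finitely many subbasic sets: one controls a tail of the null
  sequence, where \<open>x\<close> itself is small, and the others control the remaining terms one by one. A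
  character in all of them differs from \<open>x\<close> by one that is small on the whole sequence.\<close>

lemma dual_topology_discrete:
  assumes "0 \<in> A" and null: "\<And>n. finite (A - V n)"
    and rigid: "\<And>f x. Modules.additive f \<Longrightarrow> (\<And>a. a \<in> A \<Longrightarrow> cnorm (f a) \<le> 1 / 8) \<Longrightarrow> f x = 0"
  shows "dual_topology (nbhd_topology V) = discrete_topology (characters (nbhd_topology V))"
proof -
  let ?C = "characters (nbhd_topology V)" and ?D = "dual_topology (nbhd_topology V)"
  have sub: "openin ?D {f \<in> ?C. f ` K \<subseteq> U}" if "compactin (nbhd_topology V) K" "open U" for K U
    unfolding dual_topology_def by (rule topology_generated_by_Basis) (use that in blast)
  have "openin ?D {x}" if x: "x \<in> ?C" for x
  proof -
    have add_x: "Modules.additive x" and "continuous_map (nbhd_topology V) euclidean x"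
      using x by (auto simp: characters_def)
    then have "\<forall>e>0. \<exists>n. \<forall>v\<in>V n. cnorm (x v) < e"
      by (simp add: continuous_character_iff)
    then have "\<exists>n. \<forall>v\<in>V n. cnorm (x v) < 1 / 16" by (rule allE[of _ "1 / 16"]) simp
    then obtain n where n: "\<And>v. v \<in> V n \<Longrightarrow> cnorm (x v) < 1 / 16" by blast
    define N where "N a = {f \<in> ?C. f ` {a} \<subseteq> {d. cnorm (d - x a) < 1 / 8}}" for a
    define M where "M = {f \<in> ?C. f ` (A \<inter> V n) \<subseteq> {d. cnorm (d - 0) < 1 / 16}}"
    have "compactin (nbhd_topology V) (A \<inter> V n)"
    proof (rule compactin_null)
      show "finite (A \<inter> V n - V m)" for m by (rule finite_subset[OF _ null[of m]]) auto
    qed (use \<open>0 \<in> A\<close> zero in auto)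
    then have "openin ?D M" unfolding M_def by (rule sub) (rule open_cnorm_ball)
    moreover have "openin ?D (N a)" for a
      unfolding N_def by (intro sub open_cnorm_ball) (simp add: topspace_nbhd)
    ultimately have "openin ?D (\<Inter> (insert M (N ` (A - V n))))"
      using null by (intro openin_Inter) auto
    moreover have "\<Inter> (insert M (N ` (A - V n))) = {x}"
    proof (intro equalityI subsetI)
      fix f assume f: "f \<in> \<Inter> (insert M (N ` (A - V n)))"
      then have add_f: "Modules.additive f" by (auto simp: M_def characters_def)
      have "f y - x y = 0" for y
      proof (rule rigid)
        show "Modules.additive (\<lambda>y. f y - x y)"
          by (simp add: Modules.additive_def additive.add[OF add_f] additive.add[OF add_x])
        fix a assume a: "a \<in> A"
        show "cnorm (f a - x a) \<le> 1 / 8"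
        proof (cases "a \<in> V n")
          case True
          then have "cnorm (f a) < 1 / 16" using f a by (auto simp: M_def)
          then show ?thesis using n[OF True] cnorm_triangle_diff[of "f a" "x a"] by simp
        next
          case False
          then have "f \<in> N a" using f a by blast
          then show ?thesis by (simp add: N_def)
        qed
      qed
      then show "f \<in> {x}" by auto
    next
      fix f assume "f \<in> {x}"
      then show "f \<in> \<Inter> (insert M (N ` (A - V n)))" using x n by (auto simp: M_def N_def)
    qed
    ultimately show ?thesis by simp
  qed
  then show ?thesis using discrete_topology_unique[of ?C ?D] by (simp add: topspace_dual_topology)
qed

end

section \<open>The theorem\<close>

theorem corollaryA:
  fixes \<tau> :: "'a::ab_group_add topology"
  assumes "countable (UNIV :: 'a set)" and "infinite (UNIV :: 'a set)"
    and "group_topology \<tau>"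
    and "precompact_topology \<tau>"
    and "metrizable_space \<tau>"
  shows "(\<exists>\<eta>. group_topology \<eta> \<and> strictly_finer_topology \<eta> \<tau> \<and> strongly_compatible \<eta> \<tau>)
         \<and> \<not> MAP_Mackey_group \<tau>"
proof -
  obtain V where V: "nbhd_sequence V" "nbhd_topology V = \<tau>" "V 0 = UNIV"
    by (rule metrizable_group_nbhd_sequence[OF assms(3,5)])
  interpret V: nbhd_sequence V by fact
  have precompact: "precompact_topology (nbhd_topology V)" using assms(4) V(2) by simp
  obtain E where E: "\<And>j. finite (E j)" "\<And>j. E j \<subseteq> V j" "\<And>j x. x \<in> E j \<Longrightarrow> - x \<in> E j"
    and detect: "\<And>f N g. Modules.additive f \<Longrightarrow> (\<And>j u. N \<le> j \<Longrightarrow> u \<in> E j \<Longrightarrow> cnorm (f u) \<le> 1 / 8)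
      \<Longrightarrow> g \<in> V (2 * N) \<Longrightarrow> cnorm (f g) \<le> (1 / 4) / 2 ^ N"
    by (rule V.detecting_sets[OF precompact assms(1)]) blast
  define A where "A n = insert 0 (\<Union>j\<in>{n..}. E j)" for n
  have A_V: "A n \<subseteq> V n" for n using V.zero E(2) V.antimono unfolding A_def by blast
  have A: "0 \<in> A n" "m \<le> n \<Longrightarrow> A n \<subseteq> A m" "x \<in> A n \<Longrightarrow> - x \<in> A n" for m n x
    using E(3) by (auto simp: A_def)
  have A_fin: "finite (A 0 - A n)" for n
  proof (rule finite_subset)
    show "A 0 - A n \<subseteq> (\<Union>j<n. E j)"
    proof
      fix x assume "x \<in> A 0 - A n"
      then obtain j where "x \<in> E j" "\<not> n \<le> j" by (auto simp: A_def)
      then show "x \<in> (\<Union>j<n. E j)" by auto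
    qed
  qed (use E(1) in auto)
  obtain W where W: "nbhd_sequence W" "\<And>i. W i \<subseteq> V i" "\<And>i. \<exists>m. A m \<subseteq> W i"
      "nbhd_topology W \<noteq> nbhd_topology V"
    using V.strictly_finer_with_null_sets[OF precompact assms(2) A(1) A(3) A_V A(2) A_fin] by metis
  interpret W: nbhd_sequence W by fact
  have continuous: "continuous_map (nbhd_topology V) euclidean f \<longleftrightarrow> continuous_map (nbhd_topology W) euclidean f"
    if f: "Modules.additive f" for f :: "'a \<Rightarrow> circle"
  proof
    assume "continuous_map (nbhd_topology V) euclidean f"
    then show "continuous_map (nbhd_topology W) euclidean f"
      unfolding V.continuous_character_iff[OF f] W.continuous_character_iff[OF f] using W(2) by (meson subsetD)
  next
    assume "continuous_map (nbhd_topology W) euclidean f"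
    then have "\<forall>e>0. \<exists>i. \<forall>w\<in>W i. cnorm (f w) < e"
      unfolding W.continuous_character_iff[OF f] .
    then have "\<exists>i. \<forall>w\<in>W i. cnorm (f w) < 1 / 8" by (rule allE[of _ "1 / 8"]) simp
    then obtain i where i: "\<forall>w\<in>W i. cnorm (f w) < 1 / 8" ..
    obtain m where m: "A m \<subseteq> W i" using W(3) by blast
    have E_small: "cnorm (f u) \<le> 1 / 8" if "m \<le> j" "u \<in> E j" for j u
    proof -
      have "u \<in> W i" using that m by (auto simp: A_def)
      then show ?thesis using i by (simp add: less_imp_le)
    qed
    show "continuous_map (nbhd_topology V) euclidean f"
      unfolding V.continuous_character_iff[OF f]
    proof (intro allI impI)
      fix e :: real assume "e > 0"
      have "(\<lambda>N. (1 / 4) / 2 ^ N :: real) \<longlonglongrightarrow> 0" by (rule LIMSEQ_divide_realpow_zero) simp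
      then have "eventually (\<lambda>N. (1 / 4) / 2 ^ N < e) sequentially"
        using \<open>e > 0\<close> by (rule order_tendstoD(2))
      moreover have "eventually (\<lambda>N. m \<le> N) sequentially" by (rule eventually_ge_at_top)
      ultimately have "eventually (\<lambda>N. m \<le> N \<and> (1 / 4) / 2 ^ N < e) sequentially"
        by (rule eventually_conj[rotated])
      then obtain N where N: "m \<le> N" "(1 / 4) / 2 ^ N < e"
        using eventually_happens'[OF sequentially_bot] by blast
      have "cnorm (f g) < e" if "g \<in> V (2 * N)" for g
      proof -
        have "cnorm (f g) \<le> (1 / 4) / 2 ^ N"
          by (rule detect[OF f _ that]) (use E_small[OF order_trans[OF N(1)]] in blast)
        then show ?thesis using N(2) by linarith
      qed
      then show "\<exists>n. \<forall>v\<in>V n. cnorm (f v) < e" by blast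
    qed
  qed
  have chars: "characters (nbhd_topology V) = characters (nbhd_topology W)"
    using continuous by (auto simp: characters_def)
  have rigid: "f x = 0" if f: "Modules.additive f" and small: "\<And>a. a \<in> A 0 \<Longrightarrow> cnorm (f a) \<le> 1 / 8" for f x
  proof (rule additive_eq_0[OF f])
    fix g
    have "cnorm (f g) \<le> (1 / 4) / 2 ^ 0"
      using small V(3) by (intro detect[OF f]) (auto simp: A_def)
    then show "cnorm (f g) \<le> 1 / 4" by simp
  qed
  have W_null: "finite (A 0 - W i)" for i
    using W(3)[of i] A_fin by (metis Diff_mono finite_subset order_refl)
  have V_null: "finite (A 0 - V i)" for i
    by (rule finite_subset[OF _ W_null[of i]]) (use W(2) in auto)
  have "dual_topology (nbhd_topology V) = discrete_topology (characters (nbhd_topology V))"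
    by (rule V.dual_topology_discrete[of "A 0"]) (fact A(1), fact V_null, rule rigid)
  moreover have "dual_topology (nbhd_topology W) = discrete_topology (characters (nbhd_topology W))"
    by (rule W.dual_topology_discrete[of "A 0"]) (fact A(1), fact W_null, rule rigid)
  ultimately have "dual_topology (nbhd_topology W) = dual_topology (nbhd_topology V)"
    using chars by simp
  then have compat: "strongly_compatible (nbhd_topology W) \<tau>"
    by (simp add: strongly_compatible_def V(2))
  have strict: "strictly_finer_topology (nbhd_topology W) \<tau>"
    using V.finer_nbhd_topology[OF W(1,2)] W(4) by (simp add: strictly_finer_topology_def V(2))
  have "\<not> MAP_Mackey_group \<tau>"
  proof
    assume mackey: "MAP_Mackey_group \<tau>"
    then have "MAP_group (nbhd_topology W)"
      using chars W.group_topology_nbhd unfolding MAP_Mackey_group_def MAP_group_def V(2) by simp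
    then have "finer_topology \<tau> (nbhd_topology W)"
      using mackey W.group_topology_nbhd strongly_compatible_imp_compatible[OF compat]
      unfolding MAP_Mackey_group_def by blast
    then show False
      using strict unfolding strictly_finer_topology_def finer_topology_def by (metis topology_eq)
  qed
  then show ?thesis using W.group_topology_nbhd strict compat by blast
qed

end
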